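(* Let $q$ be a prime power, $t\ge 1$, $\mathbb{B}=\mathrm{GF}(q)$, $\mathbb{F}=\mathrm{GF}(q^t)$, $n=q^t$. Let $k\ge 1$ be the dimension of the full-length Reed-Solomon code over $\mathbb{F}$ and let $\mathcal{S}\subset\mathbb{F}\setminus\{0\}$. Then the dimension of $\mathcal{W}_{k,\mathcal{S}}$ is exactly the sum of the sizes of the valid cyclotomic cosets: $$\dim(\mathcal{W}_{k,\mathcal{S}})=\dim(\mathcal{V}_{k,\mathcal{S}})=\sum_{C\in\Xi^*_{k,|\mathcal{S}|}}|C|.$$
   Context: All dimensions are over $\mathbb{B}$. Let $g(x)=\prod_{\beta\in\mathcal{S}}(x-\beta)$, with $g(x)=1$ if $\mathcal{S}=\emptyset$. A polynomial $T\in\mathbb{F}[x]$ is called Trace Repair Compatible with respect to $g$ if (1) $T(\alpha)\in\mathbb{B}$ for all $\alpha\in\mathbb{F}$, and (2) the polynomial $h(x)=g(x)T(x)/x$ satisfies $h(0)=0$ and $\deg h\le n-k-1$. $\mathcal{V}_{k,\mathcal{S}}$ is the $\mathbb{B}$-vector space of all polynomials that are Trace Repair Compatible with respect to $g$. $\mathcal{W}_{k,\mathcal{S}}$ is the $\mathbb{B}$-vector space of evaluation vectors $(h(\alpha))_{\alpha\in\mathbb{F}}$, where $h(x)=g(x)f(x)/x$ for a polynomial $f$ with $f(\mathbb{F})\subseteq\mathbb{B}$, $h(0)=0$ and $\deg h\le n-k-1$. Cyclotomic cosets: $\Xi$ is the collection of orbits of $\{0,1,\dots,q^t-2\}$ under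 the map $a\mapsto qa \bmod (q^t-1)$. The set of valid cosets is $$\Xi^*_{k,|\mathcal{S}|}=\begin{cases}\{C\in\Xi : 0\notin C,\ 1\notin C,\ \max(C)\le n-k-|\mathcal{S}|\}, & k\ge 2,\\ \{C\in\Xi : 1\notin C\}, & k=1.\end{cases}$$
   Formalization: The coset formula is false for k=1 with S nonempty (it counts {0}, which the degree bound forbids); there the k≥2 coset conditions are used at k=1. The condition 1∉C is read modulo q^t-1, which matters only for q^t=2, where the literal formula fails for k=1. *)

theory Defs
  imports
    "HOL-Analysis.Finite_Cartesian_Product"
    "HOL-Computational_Algebra.Polynomial"
    "HOL-Combinatorics.Orbits"
    "HOL-Number_Theory.Prime_Powers"
begin

text \<open>
  The extension of finite fields B \<open>\<subseteq>\<close> F is given by two finite field types and an embedding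
  of the first into the second; B, as a subset of F, is the range of the embedding. Dimensions
  over B are taken with the library's \<open>vector_space.dim\<close> for the induced scalar multiplications
  \<open>\<lambda>b. smult (emb b)\<close> on polynomials and \<open>\<lambda>b v. emb b *s v\<close> on vectors indexed by F.
\<close>

definition field_embedding :: "('b::field \<Rightarrow> 'f::field) \<Rightarrow> bool" where
  "field_embedding emb \<longleftrightarrow>
     emb 1 = 1 \<and> (\<forall>a b. emb (a + b) = emb a + emb b) \<and> (\<forall>a b. emb (a * b) = emb a * emb b)"

definition g_poly :: "'f::field set \<Rightarrow> 'f poly" where
  "g_poly S = (\<Prod>\<beta>\<in>S. [:-\<beta>, 1:])"

text \<open>
  The quotient \<open>h(x) = g(x) T(x) / x\<close>. It is meant only when \<open>x\<close> divides \<open>g T\<close>, which is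
  a separate condition of \<open>trace_repair_compatible\<close>.
\<close>

definition h_poly :: "'f::field set \<Rightarrow> 'f poly \<Rightarrow> 'f poly" where
  "h_poly S T = g_poly S * T div [:0, 1:]"

text \<open>
  The degree bound is stated over the integers (\<open>n - k - 1\<close> may be \<open>-1\<close>), and the zero
  polynomial, whose degree is \<open>-\<infinity>\<close>, always satisfies it. Here \<open>n\<close> is the size of F.
\<close>

definition trace_repair_compatible ::
    "('b::field \<Rightarrow> 'f::{field,finite}) \<Rightarrow> nat \<Rightarrow> 'f set \<Rightarrow> 'f poly \<Rightarrow> bool" where
  "trace_repair_compatible emb k S T \<longleftrightarrow>
     (\<forall>\<alpha>. poly T \<alpha> \<in> range emb) \<and>
     [:0, 1:] dvd g_poly S * T \<and>
     poly (h_poly S T) 0 = 0 \<and>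
     (h_poly S T = 0 \<or> int (degree (h_poly S T)) \<le> int CARD('f) - int k - 1)"

definition V_space :: "('b::field \<Rightarrow> 'f::{field,finite}) \<Rightarrow> nat \<Rightarrow> 'f set \<Rightarrow> 'f poly set" where
  "V_space emb k S = {T. trace_repair_compatible emb k S T}"

definition W_space :: "('b::field \<Rightarrow> 'f::{field,finite}) \<Rightarrow> nat \<Rightarrow> 'f set \<Rightarrow> ('f, 'f) vec set" where
  "W_space emb k S = {(\<chi> \<alpha>. poly (h_poly S f) \<alpha>) | f. trace_repair_compatible emb k S f}"

text \<open>
  The map \<open>a \<mapsto> q a mod (q^t - 1)\<close> permutes \<open>{0..q^t - 2}\<close>, so the library's \<open>orbit\<close>, which
  collects the strictly positive iterates, is the usual orbit.
\<close>

definition cyclotomic_cosets :: "nat \<Rightarrow> nat \<Rightarrow> nat set set" where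
  "cyclotomic_cosets q t = orbit (\<lambda>a. q * a mod (q ^ t - 1)) ` {0..q ^ t - 2}"

text \<open>
  Exponents are residues modulo \<open>q^t - 1\<close>. Reducing \<open>1\<close> matters only for \<open>q^t = 2\<close>, where the
  exponents \<open>0\<close> and \<open>1\<close> coincide.
\<close>

definition bounded_cosets :: "nat \<Rightarrow> nat \<Rightarrow> nat \<Rightarrow> nat \<Rightarrow> nat set set" where
  "bounded_cosets q t k s =
     {C \<in> cyclotomic_cosets q t. 0 \<notin> C \<and> 1 mod (q ^ t - 1) \<notin> C \<and>
        int (Max C) \<le> int (q ^ t) - int k - int s}"

text \<open>
  The case \<open>k = 1\<close> ignores \<open>s\<close>. It gives the right count for \<open>s = 0\<close>, where \<open>T\<close> may have the
  exponent \<open>q^t - 1\<close>, represented by the coset of \<open>0\<close>. For \<open>k = 1\<close> and \<open>s > 0\<close> it overcounts: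
  the degree bound forbids that exponent, and the count is that of \<open>bounded_cosets\<close>.
\<close>

definition valid_cosets :: "nat \<Rightarrow> nat \<Rightarrow> nat \<Rightarrow> nat \<Rightarrow> nat set set" where
  "valid_cosets q t k s =
     (if k \<ge> 2 then bounded_cosets q t k s
      else {C \<in> cyclotomic_cosets q t. 1 mod (q ^ t - 1) \<notin> C})"

text \<open>
  The dimensions below are those of genuine vector spaces.
\<close>

lemma field_embedding_0: "field_embedding emb \<Longrightarrow> emb 0 = 0"
  unfolding field_embedding_def by (metis add_cancel_right_right)

lemma vector_space_poly:
  assumes "field_embedding emb"
  shows "vector_space (\<lambda>b. smult (emb b))"
  using assms by unfold_locales (auto simp: field_embedding_def smult_add_right smult_add_left)

lemma vector_space_vec:
  assumes "field_embedding emb"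
  shows "vector_space (\<lambda>b (v :: 'f::field ^ 'n). emb b *s v)"
  using assms
  by unfold_locales (auto simp: field_embedding_def vec_eq_iff algebra_simps)

lemma h_poly_add:
  assumes "[:0, 1:] dvd g_poly S * T" "[:0, 1:] dvd g_poly S * U"
  shows "h_poly S (T + U) = h_poly S T + h_poly S U"
  using assms by (simp add: h_poly_def distrib_left div_plus_div_distrib_dvd_left)

lemma h_poly_smult: "h_poly S (smult c T) = smult c (h_poly S T)"
  by (simp add: h_poly_def div_smult_left)

lemma trace_repair_compatible_0:
  assumes "field_embedding emb"
  shows "trace_repair_compatible emb k S 0"
  using field_embedding_0[OF assms]
  by (auto simp: trace_repair_compatible_def h_poly_def intro: range_eqI[of _ _ 0])

lemma trace_repair_compatible_add:
  fixes emb :: "'b::field \<Rightarrow> 'f::{field,finite}"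
  assumes emb: "field_embedding emb"
    and T: "trace_repair_compatible emb k S T" and U: "trace_repair_compatible emb k S U"
  shows "trace_repair_compatible emb k S (T + U)"
proof -
  have h: "h_poly S (T + U) = h_poly S T + h_poly S U"
    using T U by (intro h_poly_add) (auto simp: trace_repair_compatible_def)
  have "poly T \<alpha> + poly U \<alpha> \<in> range emb" for \<alpha>
  proof -
    obtain a b where "poly T \<alpha> = emb a" "poly U \<alpha> = emb b"
      using T U unfolding trace_repair_compatible_def by (metis imageE)
    then have "poly T \<alpha> + poly U \<alpha> = emb (a + b)"
      using emb by (simp add: field_embedding_def)
    then show ?thesis by simp
  qed
  moreover have "h_poly S T + h_poly S U = 0 \<or>
      int (degree (h_poly S T + h_poly S U)) \<le> int CARD('f) - int k - 1"
  proof (cases "h_poly S T = 0 \<or> h_poly S U = 0")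
    case True
    then show ?thesis using T U by (auto simp: trace_repair_compatible_def)
  next
    case False
    then show ?thesis
      using T U degree_add_le_max[of "h_poly S T" "h_poly S U"]
      by (auto simp: trace_repair_compatible_def)
  qed
  ultimately show ?thesis
    using T U h by (auto simp: trace_repair_compatible_def distrib_left)
qed

lemma trace_repair_compatible_smult:
  fixes emb :: "'b::field \<Rightarrow> 'f::{field,finite}"
  assumes emb: "field_embedding emb" and T: "trace_repair_compatible emb k S T"
  shows "trace_repair_compatible emb k S (smult (emb b) T)"
proof -
  have "emb b * poly T \<alpha> \<in> range emb" for \<alpha>
  proof -
    obtain a where "poly T \<alpha> = emb a"
      using T unfolding trace_repair_compatible_def by (metis imageE)
    then have "emb b * poly T \<alpha> = emb (b * a)"
      using emb by (simp add: field_embedding_def)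
    then show ?thesis by simp
  qed
  then show ?thesis
    using T by (auto simp: trace_repair_compatible_def h_poly_smult dvd_smult)
qed

lemma subspace_V_space:
  assumes "field_embedding emb"
  shows "module.subspace (\<lambda>b. smult (emb b)) (V_space emb k S)"
proof -
  interpret vector_space "\<lambda>b. smult (emb b)" by (rule vector_space_poly[OF assms])
  show ?thesis
    using assms
    by (auto simp: subspace_def V_space_def trace_repair_compatible_0
        trace_repair_compatible_add trace_repair_compatible_smult)
qed

lemma subspace_W_space:
  fixes emb :: "'b::field \<Rightarrow> 'f::{field,finite}"
  assumes "field_embedding emb"
  shows "module.subspace (\<lambda>b v. emb b *s v) (W_space emb k S)"
proof -
  interpret vector_space "\<lambda>b (v :: ('f, 'f) vec). emb b *s v" by (rule vector_space_vec[OF assms])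
  show ?thesis
  proof (rule subspaceI)
    show "0 \<in> W_space emb k S"
      using trace_repair_compatible_0[OF assms]
      by (auto simp: W_space_def vec_eq_iff h_poly_def intro!: exI[of _ 0])
  next
    fix v w assume "v \<in> W_space emb k S" "w \<in> W_space emb k S"
    then obtain T U where TU: "trace_repair_compatible emb k S T" "trace_repair_compatible emb k S U"
      and vw: "v = (\<chi> \<alpha>. poly (h_poly S T) \<alpha>)" "w = (\<chi> \<alpha>. poly (h_poly S U) \<alpha>)"
      by (auto simp: W_space_def)
    have "h_poly S (T + U) = h_poly S T + h_poly S U"
      using TU by (intro h_poly_add) (auto simp: trace_repair_compatible_def)
    then have "v + w = (\<chi> \<alpha>. poly (h_poly S (T + U)) \<alpha>)"
      by (simp add: vw vec_eq_iff)
    then show "v + w \<in> W_space emb k S"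
      using trace_repair_compatible_add[OF assms TU] by (auto simp: W_space_def)
  next
    fix b v assume "v \<in> W_space emb k S"
    then obtain T where T: "trace_repair_compatible emb k S T"
      and v: "v = (\<chi> \<alpha>. poly (h_poly S T) \<alpha>)"
      by (auto simp: W_space_def)
    have "emb b *s v = (\<chi> \<alpha>. poly (h_poly S (smult (emb b) T)) \<alpha>)"
      by (simp add: v vec_eq_iff h_poly_smult)
    then show "emb b *s v \<in> W_space emb k S"
      using trace_repair_compatible_smult[OF assms T] by (auto simp: W_space_def)
  qed
qed

end

theory Submission
  imports Defs
begin

text \<open>
  A subspace \<open>U\<close> over a field with \<open>q\<close> elements has \<open>q ^ dim U\<close> elements, so it suffices to count
  polynomials. As \<open>0 \<notin> S\<close>, the conditions on \<open>h\<close> say that \<open>T\<close> has no terms of degree \<open>0\<close> or \<open>1\<close>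
  and that \<open>deg T \<le> n - k - |S|\<close>. Comparing \<open>T\<close> with \<open>T ^ q\<close> modulo \<open>x ^ n - x\<close>, the values of \<open>T\<close>
  lie in B if and only if the coefficients satisfy \<open>a (q i) = a i ^ q\<close>, with \<open>i\<close> read modulo \<open>n - 1\<close>.
  Hence the coefficients along a coset \<open>C\<close> are determined by one of them, which may be any root of
  \<open>x ^ (q ^ |C|) = x\<close>; since \<open>|C|\<close> divides \<open>t\<close>, there are \<open>q ^ |C|\<close> such roots. The coefficients vanish
  on every coset that contains a forbidden exponent.
\<close>

section \<open>Counting the elements of a subspace\<close>

lemma (in vector_space) card_subspace:
  assumes "finite (UNIV :: 'a set)" "finite U" "subspace U"
  shows "card U = card (UNIV :: 'a set) ^ dim U"
proof -
  obtain B where B: "B \<subseteq> U" "independent B" "U \<subseteq> span B" "card B = dim U"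
    by (rule basis_exists)
  have fB: "finite B" using B assms finite_subset by blast
  have "span B = U" using B assms span_minimal by blast
  have "bij_betw (\<lambda>u. \<Sum>v\<in>B. scale (u v) v) (B \<rightarrow>\<^sub>E UNIV) U"
  proof (rule bij_betw_imageI)
    show "inj_on (\<lambda>u. \<Sum>v\<in>B. scale (u v) v) (B \<rightarrow>\<^sub>E UNIV)"
    proof (rule inj_onI)
      fix u w :: "'b \<Rightarrow> 'a"
      assume uw: "u \<in> B \<rightarrow>\<^sub>E UNIV" "w \<in> B \<rightarrow>\<^sub>E UNIV"
        and "(\<Sum>v\<in>B. scale (u v) v) = (\<Sum>v\<in>B. scale (w v) v)"
      then have "(\<Sum>v\<in>B. scale (u v - w v) v) = 0"
        by (simp add: scale_left_diff_distrib sum_subtractf)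
      then have "u v = w v" if "v \<in> B" for v
        using independentD[OF B(2) fB order_refl, of "\<lambda>v. u v - w v"] that by simp
      then show "u = w" using uw by (intro PiE_ext) auto
    qed
    have "(\<lambda>u. \<Sum>v\<in>B. scale (u v) v) ` (B \<rightarrow>\<^sub>E UNIV) = range (\<lambda>u. \<Sum>v\<in>B. scale (u v) v)"
    proof (intro equalityI subsetI)
      fix x assume "x \<in> range (\<lambda>u. \<Sum>v\<in>B. scale (u v) v)"
      then obtain u where "x = (\<Sum>v\<in>B. scale (u v) v)" by auto
      also have "\<dots> = (\<Sum>v\<in>B. scale (restrict u B v) v)" by (rule sum.cong) auto
      finally have x: "x = (\<Sum>v\<in>B. scale (restrict u B v) v)" .
      show "x \<in> (\<lambda>u. \<Sum>v\<in>B. scale (u v) v) ` (B \<rightarrow>\<^sub>E UNIV)"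
        by (rule image_eqI[where x = "restrict u B"]) (fact x, simp add: PiE_iff)
    qed auto
    then show "(\<lambda>u. \<Sum>v\<in>B. scale (u v) v) ` (B \<rightarrow>\<^sub>E UNIV) = U"
      by (simp only: span_finite[OF fB, symmetric] \<open>span B = U\<close>)
  qed
  then have "card (B \<rightarrow>\<^sub>E (UNIV :: 'a set)) = card U" by (rule bij_betw_same_card)
  then show ?thesis using fB B by (simp add: card_PiE)
qed

section \<open>Orbits and equivariant maps\<close>

text \<open>Before the first return time \<open>m\<close> the iterates are distinct, and from there
  on they repeat with period \<open>m\<close>; so the orbit is a cycle of length
  \<open>m\<close>.\<close>

lemma funpow_eq_iff_mod_card_orbit:
  assumes self: "c \<in> orbit f c"
  shows "(f ^^ i) c = (f ^^ j) c \<longleftrightarrow> i mod card (orbit f c) = j mod card (orbit f c)"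
proof -
  define m where "m = funpow_dist1 f c c"
  have inj: "inj_on (\<lambda>n. (f ^^ n) c) {0..<m}"
    unfolding m_def by (rule inj_on_funpow_dist1[OF self])
  have m: "(f ^^ m) c = c" "m > 0" unfolding m_def by (simp_all only: funpow_dist1_prop[OF self])
  have "card (orbit f c) = m"
    using orbit_conv_funpow_dist1[OF self] card_image[OF inj] by (simp add: m_def)
  moreover have "i mod m = j mod m" if "(f ^^ i) c = (f ^^ j) c"
  proof (rule inj_onD[OF inj])
    show "(f ^^ (i mod m)) c = (f ^^ (j mod m)) c"
      using that by (simp add: funpow_mod_eq[OF m(1)])
  qed (use m(2) in auto)
  moreover have "(f ^^ i) c = (f ^^ j) c" if "i mod m = j mod m"
    using that funpow_mod_eq[OF m(1)] by metis
  ultimately show ?thesis by auto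
qed

lemma funpow_card_orbit:
  assumes self: "c \<in> orbit f c"
  shows "(f ^^ card (orbit f c)) c = c"
  using funpow_eq_iff_mod_card_orbit[OF self, of "card (orbit f c)" 0] by simp

text \<open>This makes it legitimate to define a map on the orbit of \<open>c\<close> by sending
  \<open>(f ^^ i) c\<close> to \<open>(g ^^ i) x\<close>: the value does not depend on the choice of
  \<open>i\<close>.\<close>

lemma funpow_eq_transfer:
  assumes self: "c \<in> orbit f c" and fixpt: "(g ^^ card (orbit f c)) x = x"
    and eq: "(f ^^ i) c = (f ^^ j) c"
  shows "(g ^^ i) x = (g ^^ j) x"
  using eq funpow_eq_iff_mod_card_orbit[OF self] funpow_mod_eq[OF fixpt] by metis

text \<open>The coefficients of a polynomial with values in B form such a map, with \<open>f\<close>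
  multiplying exponents by \<open>q\<close> and \<open>g\<close> raising to the power
  \<open>q\<close>. Extensionality leaves only the values on \<open>X\<close> to be counted.\<close>

definition equivariant_maps :: "'a set \<Rightarrow> ('a \<Rightarrow> 'a) \<Rightarrow> ('b \<Rightarrow> 'b) \<Rightarrow> ('a \<Rightarrow> 'b) set" where
  "equivariant_maps X f g = {a \<in> X \<rightarrow>\<^sub>E UNIV. \<forall>x\<in>X. a (f x) = g (a x)}"

lemma equivariant_maps_funpow:
  assumes "a \<in> equivariant_maps X f g" "\<And>x. x \<in> X \<Longrightarrow> f x \<in> X" "x \<in> X"
  shows "a ((f ^^ j) x) = (g ^^ j) (a x)"
proof -
  have "(f ^^ j) x \<in> X" for j using assms by (induction j) auto
  then show ?thesis using assms(1) by (induction j) (auto simp: equivariant_maps_def)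
qed

text \<open>On each orbit \<open>C\<close> the map is determined by its value \<open>y\<close> at a
  representative, and \<open>y\<close> extends to all of \<open>C\<close> exactly when going once
  around the cycle brings it back to itself. Distinct orbits impose no conditions on each
  other.\<close>

lemma card_equivariant_maps:
  fixes f :: "'a \<Rightarrow> 'a" and g :: "'b \<Rightarrow> 'b"
  assumes fin: "finite X" and closed: "\<And>x. x \<in> X \<Longrightarrow> f x \<in> X"
    and self: "\<And>x. x \<in> X \<Longrightarrow> x \<in> orbit f x"
  shows "card (equivariant_maps X f g) = (\<Prod>C\<in>orbit f ` X. card {y. (g ^^ card C) y = y})"
proof -
  define rep where "rep C = (SOME c. c \<in> C \<inter> X)" for C :: "'a set"
  have rep: "rep C \<in> X" "orbit f (rep C) = C" if C: "C \<in> orbit f ` X" for C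
  proof -
    obtain c where c: "c \<in> X" "C = orbit f c" using C by auto
    then have "c \<in> C \<inter> X" using self by auto
    then have "rep C \<in> C \<inter> X" unfolding rep_def by (rule someI)
    moreover have "cyclic_on f C" using c self by (auto simp: cyclic_on_def)
    ultimately show "rep C \<in> X" "orbit f (rep C) = C" using orbit_cyclic_eq3[of f C] by blast+
  qed
  have orbit_eq: "orbit f (f x) = orbit f x" if "x \<in> X" for x
    using self[OF that] by (rule self_in_orbit_step)
  have repf: "x \<in> orbit f (rep (orbit f x))" if "x \<in> X" for x
    using rep(2)[of "orbit f x"] self[OF that] that by auto
  let ?P = "\<Pi>\<^sub>E C\<in>orbit f ` X. {y. (g ^^ card C) y = y}"
  have "bij_betw (\<lambda>a. \<lambda>C\<in>orbit f ` X. a (rep C)) (equivariant_maps X f g) ?P"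
  proof (rule bij_betw_imageI)
    show "inj_on (\<lambda>a. \<lambda>C\<in>orbit f ` X. a (rep C)) (equivariant_maps X f g)"
    proof (rule inj_onI)
      fix a b assume a: "a \<in> equivariant_maps X f g" and b: "b \<in> equivariant_maps X f g"
        and eq: "(\<lambda>C\<in>orbit f ` X. a (rep C)) = (\<lambda>C\<in>orbit f ` X. b (rep C))"
      have "a x = b x" if x: "x \<in> X" for x
      proof -
        obtain j where j: "x = (f ^^ j) (rep (orbit f x))"
          using repf[OF x] by (auto simp: orbit_altdef)
        have r: "rep (orbit f x) \<in> X" using rep x by blast
        have "a (rep (orbit f x)) = b (rep (orbit f x))"
          using fun_cong[OF eq, of "orbit f x"] x by simp
        then show ?thesis
          using equivariant_maps_funpow[OF a closed r, of j] equivariant_maps_funpow[OF b closed r, of j] j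
          by simp
      qed
      then show "a = b" using a b by (intro PiE_ext[of _ X]) (auto simp: equivariant_maps_def)
    qed
    show "(\<lambda>a. \<lambda>C\<in>orbit f ` X. a (rep C)) ` equivariant_maps X f g = ?P"
    proof (intro equalityI subsetI)
      fix h assume "h \<in> (\<lambda>a. \<lambda>C\<in>orbit f ` X. a (rep C)) ` equivariant_maps X f g"
      then obtain a where a: "a \<in> equivariant_maps X f g"
        and h: "h = (\<lambda>C\<in>orbit f ` X. a (rep C))" by auto
      have "(g ^^ card C) (a (rep C)) = a (rep C)" if C: "C \<in> orbit f ` X" for C
        using equivariant_maps_funpow[OF a closed rep(1)[OF C], of "card C"]
          funpow_card_orbit[OF self[OF rep(1)[OF C]]] rep(2)[OF C] by simp
      then show "h \<in> ?P" by (auto simp: h)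
    next
      fix h assume h: "h \<in> ?P"
      \<comment> \<open>Some number of steps from the representative to \<open>x\<close>; by
        \<open>transfer\<close> below it does not matter which one is chosen.\<close>
      define dist where "dist x = (SOME j. (f ^^ j) (rep (orbit f x)) = x)" for x
      have dist: "(f ^^ dist x) (rep (orbit f x)) = x" if "x \<in> X" for x
      proof -
        have "\<exists>j. (f ^^ j) (rep (orbit f x)) = x"
          using repf[OF that] unfolding orbit_altdef[of f "rep (orbit f x)"] by (auto dest: sym)
        then show ?thesis unfolding dist_def by (rule someI_ex)
      qed
      define a where "a = (\<lambda>x\<in>X. (g ^^ dist x) (h (orbit f x)))"
      have transfer: "(g ^^ i) (h (orbit f x)) = (g ^^ j) (h (orbit f x))"
        if x: "x \<in> X" and eq: "(f ^^ i) (rep (orbit f x)) = (f ^^ j) (rep (orbit f x))" for i j x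
      proof (rule funpow_eq_transfer[OF _ _ eq])
        show "rep (orbit f x) \<in> orbit f (rep (orbit f x))" using self rep x by blast
        have "(g ^^ card (orbit f x)) (h (orbit f x)) = h (orbit f x)"
          using h x by (auto simp: PiE_iff)
        then show "(g ^^ card (orbit f (rep (orbit f x)))) (h (orbit f x)) = h (orbit f x)"
          using rep(2) x by simp
      qed
      have "a (f x) = g (a x)" if x: "x \<in> X" for x
      proof -
        \<comment> \<open>\<open>dist (f x)\<close> and \<open>Suc (dist x)\<close> may differ, but
          both numbers of steps end at \<open>f x\<close>, which is all that \<open>transfer\<close>
          asks for.\<close>
        have "(f ^^ dist (f x)) (rep (orbit f x)) = (f ^^ Suc (dist x)) (rep (orbit f x))"
          using dist[OF x] dist[OF closed[OF x]] orbit_eq[OF x] by simp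
        from transfer[OF x this] show ?thesis
          using x closed by (simp add: a_def orbit_eq)
      qed
      then have "a \<in> equivariant_maps X f g" by (auto simp: equivariant_maps_def a_def)
      moreover have "h = (\<lambda>C\<in>orbit f ` X. a (rep C))"
      proof
        fix C
        show "h C = (\<lambda>C\<in>orbit f ` X. a (rep C)) C"
        proof (cases "C \<in> orbit f ` X")
          case C: True
          have "(f ^^ dist (rep C)) (rep C) = (f ^^ 0) (rep C)"
            using dist[OF rep(1)[OF C]] rep(2)[OF C] by simp
          then have "(g ^^ dist (rep C)) (h C) = (g ^^ 0) (h C)"
            using transfer[OF rep(1)[OF C], of _ 0] rep(2)[OF C] by simp
          then show ?thesis using C rep[OF C] by (simp add: a_def)
        next
          case False
          then show ?thesis using PiE_arb[OF h False] by (auto simp: restrict_def)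
        qed
      qed
      ultimately show "h \<in> (\<lambda>a. \<lambda>C\<in>orbit f ` X. a (rep C)) ` equivariant_maps X f g" by blast
    qed
  qed
  then have "card (equivariant_maps X f g) = card ?P" by (rule bij_betw_same_card)
  also have "\<dots> = (\<Prod>C\<in>orbit f ` X. card {y. (g ^^ card C) y = y})"
    using fin by (simp add: card_PiE)
  finally show ?thesis .
qed

section \<open>Finite fields: roots of unity, Frobenius and the subfield B\<close>

text \<open>Multiplication by \<open>x\<close> permutes the nonzero elements, so their product is
  unchanged when each factor is multiplied by \<open>x\<close>; cancel it.\<close>

lemma finite_field_power_card_minus_1:
  fixes x :: "'f::{field,finite}"
  assumes "x \<noteq> 0"
  shows "x ^ (CARD('f) - 1) = 1"
proof -
  have "(\<Prod>y\<in>UNIV-{0}. y) = (\<Prod>y\<in>UNIV-{0}. x * y)"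
    by (rule prod.reindex_bij_witness[of _ "\<lambda>y. x * y" "\<lambda>y. y / x"]) (use assms in auto)
  also have "\<dots> = x ^ (CARD('f) - 1) * (\<Prod>y\<in>UNIV-{0}. y)"
    by (simp add: prod.distrib card_Diff_singleton)
  finally show ?thesis by simp
qed

text \<open>At most \<open>d\<close> by degree. At least \<open>d\<close> because all
  \<open>d * e\<close> nonzero elements are roots of
  \<open>x ^ (d * e) - 1 = (x ^ d - 1) * H\<close>, and the cofactor \<open>H\<close> accounts for
  at most \<open>d * (e - 1)\<close> of them.\<close>

lemma card_roots_of_unity:
  assumes d: "d dvd CARD('f::{field,finite}) - 1" and "d > 0"
  shows "card {x::'f. x ^ d = 1} = d"
proof (rule antisym)
  have nz: "monom (1::'f) d - 1 \<noteq> 0"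
  proof
    assume "monom (1::'f) d - 1 = 0"
    then have "coeff (monom (1::'f) d - 1) d = 0" by simp
    then show False using \<open>d > 0\<close> by simp
  qed
  have "card {x. poly (monom (1::'f) d - 1) x = 0} \<le> degree (monom (1::'f) d - 1)"
    by (rule card_poly_roots_bound[OF nz])
  also have "\<dots> \<le> d" by (intro degree_diff_le) (auto simp: degree_monom_eq)
  finally show "card {x::'f. x ^ d = 1} \<le> d" by (simp add: poly_monom)
next
  obtain e where e: "CARD('f) - 1 = d * e" using d by blast
  have "CARD('f) \<ge> card {0, 1::'f}" by (intro card_mono) auto
  then have "CARD('f) \<ge> 2" by simp
  then have "e > 0" using e by (cases e) auto
  define H where "H = (\<Sum>i<e. monom (1::'f) (d * i))"
  have degH: "degree H \<le> d * (e - 1)"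
    unfolding H_def by (intro degree_sum_le) (auto simp: degree_monom_eq)
  have "coeff H 0 = 1"
    using \<open>e > 0\<close> \<open>d > 0\<close> by (simp add: H_def coeff_sum sum.delta)
  then have "H \<noteq> 0" by auto
  have "UNIV - {0} \<subseteq> {x::'f. x ^ d = 1} \<union> {x. poly H x = 0}"
  proof safe
    fix x :: 'f assume "x \<noteq> 0" "poly H x \<noteq> 0"
    have "(x ^ d) ^ e = 1"
      using finite_field_power_card_minus_1[OF \<open>x \<noteq> 0\<close>] e by (simp add: power_mult)
    then have "(x ^ d - 1) * poly H x = 0"
      using power_diff_1_eq[of "x ^ d" e] by (simp add: H_def poly_sum poly_monom power_mult)
    then show "x ^ d = 1" using \<open>poly H x \<noteq> 0\<close> by simp
  qed
  then have "card (UNIV - {0::'f}) \<le> card ({x::'f. x ^ d = 1} \<union> {x. poly H x = 0})"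
    by (intro card_mono) auto
  also have "\<dots> \<le> card {x::'f. x ^ d = 1} + card {x. poly H x = 0}" by (rule card_Un_le)
  also have "card {x. poly H x = 0} \<le> d * (e - 1)"
    using card_poly_roots_bound[OF \<open>H \<noteq> 0\<close>] degH by linarith
  finally have "d * e \<le> card {x::'f. x ^ d = 1} + d * (e - 1)"
    using e by (simp add: card_Diff_singleton)
  moreover have "d * e = d + d * (e - 1)" using \<open>e > 0\<close> by (cases e) auto
  ultimately show "d \<le> card {x::'f. x ^ d = 1}" by linarith
qed

lemma power_minus_1_dvd_nat:
  fixes q :: nat
  assumes "m dvd t"
  shows "q ^ m - 1 dvd q ^ t - 1"
proof (cases "q = 0")
  case False
  obtain s where s: "t = m * s" using assms by blast
  have "int q ^ m - 1 dvd (int q ^ m) ^ s - 1"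
    by (simp add: power_diff_1_eq)
  moreover have "int (q ^ m - 1) = int q ^ m - 1" "int (q ^ t - 1) = (int q ^ m) ^ s - 1"
    using False s by (auto simp: of_nat_diff power_mult)
  ultimately show ?thesis by (simp flip: int_dvd_int_iff)
qed (use assms in \<open>auto simp: power_0_left\<close>)

text \<open>The nonzero fixed points are the roots of unity of order dividing
  \<open>q ^ m - 1\<close>, and this number divides \<open>q ^ t - 1\<close> because
  \<open>m\<close> divides \<open>t\<close>.\<close>

lemma card_power_fixed_points:
  assumes card: "CARD('f::{field,finite}) = q ^ t" and "m dvd t" "m > 0"
  shows "card {x::'f. x ^ (q ^ m) = x} = q ^ m"
proof -
  have "CARD('f) \<ge> card {0, 1::'f}" by (intro card_mono) auto
  then have "q ^ t \<ge> 2" using card by simp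
  then have "q > 1" by (cases "t = 0"; cases "q = 0"; cases "q = 1") (auto simp: power_0_left)
  then have qm: "q ^ m > 1" using \<open>m > 0\<close> by (rule one_less_power)
  have "x ^ (q ^ m) = x \<longleftrightarrow> x = 0 \<or> x ^ (q ^ m - 1) = 1" for x :: 'f
  proof -
    have "x ^ (q ^ m) = x * x ^ (q ^ m - 1)" using qm by (metis power_eq_if not_less0)
    then show ?thesis by auto
  qed
  then have "{x::'f. x ^ (q ^ m) = x} = insert 0 {x. x ^ (q ^ m - 1) = 1}" by auto
  moreover have "(0::'f) \<notin> {x. x ^ (q ^ m - 1) = 1}" using qm by (simp add: power_0_left)
  moreover have "card {x::'f. x ^ (q ^ m - 1) = 1} = q ^ m - 1"
    using qm power_minus_1_dvd_nat[OF \<open>m dvd t\<close>, of q] card by (intro card_roots_of_unity) auto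
  ultimately show ?thesis using qm by simp
qed

lemma funpow_power:
  fixes x :: "'a::monoid_mult"
  shows "((\<lambda>x. x ^ q) ^^ j) x = x ^ (q ^ j)"
  by (induction j) (auto simp: mult.commute simp flip: power_mult)

text \<open>The characteristic divides \<open>q ^ t\<close>, so the prime power \<open>q\<close> is
  a power of the characteristic and \<open>x ^ q\<close> is additive in \<open>x\<close>.\<close>

lemma frobenius_sum:
  fixes f :: "'i \<Rightarrow> 'f::{field,finite}"
  assumes q: "primepow q" and card: "CARD('f) = q ^ t"
  shows "(\<Sum>i\<in>A. f i) ^ q = (\<Sum>i\<in>A. f i ^ q)"
proof -
  have p: "prime CHAR('f)" by (rule prime_CHAR_semidom) (simp add: finite_imp_CHAR_pos)
  obtain r e where r: "prime r" "q = r ^ e" using q by (auto simp: primepow_def)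
  \<comment> \<open>Translation by 1 permutes the field; comparing the two sums shows that the size
    of the field is zero in the field.\<close>
  have "(\<Sum>y\<in>UNIV. y + 1 :: 'f) = (\<Sum>y\<in>UNIV. y)"
    by (rule sum.reindex_bij_witness[of _ "\<lambda>y. y - 1" "\<lambda>y. y + 1"]) auto
  then have "of_nat CARD('f) = (0 :: 'f)" by (simp add: sum.distrib)
  then have "CHAR('f) dvd CARD('f)" by (simp only: of_nat_eq_0_iff_char_dvd)
  then have "CHAR('f) dvd r ^ (e * t)" using card r by (simp add: power_mult)
  then have "CHAR('f) = r" using p r(1) by (metis prime_dvd_power primes_dvd_imp_eq)
  then show ?thesis using p r by (intro freshmans_dream_sum') auto
qed

text \<open>Every element of the range is a root of \<open>x ^ q - x\<close>. Injectivity gives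
  \<open>q\<close> such elements, and there are no more than \<open>q\<close> roots.\<close>

lemma range_field_embedding:
  fixes emb :: "'b::{field,finite} \<Rightarrow> 'f::{field,finite}"
  assumes emb: "field_embedding emb" and q: "CARD('b) = q"
  shows "range emb = {x. x ^ q = x}"
proof -
  have "emb b ^ j = emb (b ^ j)" for b j
    using emb by (induction j) (auto simp: field_embedding_def)
  moreover have "b ^ q = b" for b :: 'b
  proof (cases "b = 0")
    case False
    have "b ^ q = b * b ^ (q - 1)"
      using q by (metis finite_UNIV_card_ge_0 finite power_minus_mult mult.commute)
    then show ?thesis using finite_field_power_card_minus_1[OF False] q by simp
  qed (use q in \<open>auto simp: power_0_left\<close>)
  ultimately have "range emb \<subseteq> {x. x ^ q = x}" by auto
  have "inj emb"
  proof (rule injI)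
    fix x y assume eq: "emb x = emb y"
    show "x = y"
    proof (rule ccontr)
      assume "x \<noteq> y"
      have "emb (x - y) + emb y = emb x"
        using emb unfolding field_embedding_def by (metis diff_add_cancel)
      then have "emb (x - y) = 0" using eq by simp
      moreover have "emb ((x - y) * inverse (x - y)) = 1"
        using emb \<open>x \<noteq> y\<close> by (simp add: field_embedding_def)
      ultimately show False using emb by (auto simp: field_embedding_def)
    qed
  qed
  then have cr: "card (range emb) = q" using q by (simp add: card_image)
  have "CARD('b) \<ge> card {0, 1::'b}" by (intro card_mono) auto
  then have "q > 1" using q by simp
  have "monom (1::'f) q - monom 1 1 \<noteq> 0"
  proof
    assume "monom (1::'f) q - monom 1 1 = 0"
    then have "coeff (monom (1::'f) q - monom 1 1) q = 0" by simp
    then show False using \<open>q > 1\<close> by simp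
  qed
  then have "card {x. poly (monom (1::'f) q - monom 1 1) x = 0} \<le> degree (monom (1::'f) q - monom 1 1)"
    by (rule card_poly_roots_bound)
  also have "\<dots> \<le> q" using \<open>q > 1\<close> by (intro degree_diff_le) (auto simp: degree_monom_eq)
  finally have "card {x::'f. x ^ q = x} \<le> q" by (simp add: poly_monom)
  then show ?thesis using cr \<open>range emb \<subseteq> _\<close> by (intro card_subset_eq) (auto simp: card_mono antisym)
qed

section \<open>Exponents of \<open>x\<close> and their cyclotomic cosets\<close>

locale finite_field_extension =
  fixes emb :: "'b::{field,finite} \<Rightarrow> 'f::{field,finite}" and q t :: nat
  assumes primepow_q: "primepow q" and t_pos: "t \<ge> 1"
    and card_base: "CARD('b) = q" and card_ext: "CARD('f) = q ^ t"
    and emb: "field_embedding emb"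
begin

text \<open>The order of the multiplicative group of F.\<close>

definition N :: nat where "N = q ^ t - 1"

definition shift :: "nat \<Rightarrow> nat" where "shift r = q * r mod N"

text \<open>The powers of \<open>x\<close> that occur have positive exponent at most \<open>N\<close>, so the residue \<open>0\<close> stands
  for the exponent \<open>N\<close>.\<close>

definition exponent :: "nat \<Rightarrow> nat" where "exponent r = (if r = 0 then N else r)"

lemma q_gt_1: "q > 1"
  using primepow_q by (simp add: primepow_gt_Suc_0)

lemma N_pos: "N > 0"
  using one_less_power[OF q_gt_1, of t] t_pos by (simp add: N_def)

lemma power_t_eq: "q ^ t = Suc N"
  using N_pos by (simp add: N_def)

lemma bij_exponent: "bij_betw exponent {..<N} {1..N}"
  by (rule bij_betwI[where g = "\<lambda>i. if i = N then 0 else i"])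
    (use N_pos in \<open>auto simp: exponent_def\<close>)

lemma exponent_pos: "exponent r > 0"
  using N_pos by (simp add: exponent_def)

lemma exponent_eq_iff: "r < N \<Longrightarrow> r' < N \<Longrightarrow> exponent r = exponent r' \<longleftrightarrow> r = r'"
  using bij_exponent by (auto simp: bij_betw_def inj_on_def)

lemma exponent_le: "r < N \<Longrightarrow> exponent r \<le> N"
  by (simp add: exponent_def)

text \<open>For nonzero \<open>y\<close> this is periodicity with period \<open>N\<close>; at
  \<open>y = 0\<close> both sides vanish since both exponents are positive.\<close>

lemma power_exponent_mod:
  fixes y :: 'f
  assumes "i > 0"
  shows "y ^ exponent (i mod N) = y ^ i"
proof (cases "y = 0")
  case True
  then show ?thesis using assms exponent_pos by (simp add: power_0_left)
next
  case False
  then have y: "y ^ N = 1" using finite_field_power_card_minus_1[of y] card_ext by (simp add: power_t_eq)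
  have "y ^ i = (y ^ N) ^ (i div N) * y ^ (i mod N)"
    by (simp flip: power_mult power_add)
  then show ?thesis using y by (simp add: exponent_def)
qed

lemma power_exponent_shift:
  fixes y :: 'f
  shows "y ^ exponent (shift r) = (y ^ exponent r) ^ q"
proof -
  have "shift r = exponent r * q mod N" by (simp add: shift_def exponent_def mult.commute)
  then show ?thesis
    using power_exponent_mod[of "exponent r * q" y] exponent_pos q_gt_1 by (simp add: power_mult)
qed

lemma shift_less: "shift r < N"
  using N_pos by (simp add: shift_def)

lemma funpow_shift: "r < N \<Longrightarrow> (shift ^^ j) r = q ^ j * r mod N"
proof (induction j)
  case (Suc j)
  then show ?case by (simp add: shift_def mod_mult_right_eq mult.assoc)
qed simp

text \<open>\<open>q ^ t\<close> is 1 modulo \<open>N\<close>.\<close>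

lemma funpow_shift_t:
  assumes "r < N"
  shows "(shift ^^ t) r = r"
  unfolding funpow_shift[OF assms] power_t_eq using assms by simp

lemma self_in_orbit_shift:
  assumes "r < N"
  shows "r \<in> orbit shift r"
proof -
  have "r = (shift ^^ t) r" "0 < t" using funpow_shift_t[OF assms] t_pos by auto
  then show ?thesis unfolding orbit_altdef by blast
qed

lemma orbit_shift_subset: "orbit shift r \<subseteq> {..<N}"
proof
  fix x assume "x \<in> orbit shift r"
  then show "x \<in> {..<N}" by induction (use shift_less in auto)
qed

lemma card_orbit_dvd: "r < N \<Longrightarrow> card (orbit shift r) dvd t"
  using funpow_eq_iff_mod_card_orbit[OF self_in_orbit_shift, of r t 0] funpow_shift_t by auto

lemma card_orbit_pos: "r < N \<Longrightarrow> card (orbit shift r) > 0"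
  using self_in_orbit_shift finite_orbit orbit_nonempty card_gt_0_iff by metis

lemma bij_shift: "bij_betw shift {..<N} {..<N}"
proof -
  have "inj_on shift {..<N}"
  proof (rule inj_onI)
    fix r r' assume r: "r \<in> {..<N}" "r' \<in> {..<N}" and "shift r = shift r'"
    \<comment> \<open>Since \<open>t\<close> shifts are the identity, \<open>t - 1\<close> further
      shifts undo one.\<close>
    then have "(shift ^^ (t - 1)) (shift r) = (shift ^^ (t - 1)) (shift r')" by simp
    then have "(shift ^^ Suc (t - 1)) r = (shift ^^ Suc (t - 1)) r'"
      by (simp only: funpow_Suc_right comp_apply)
    then show "r = r'" using r t_pos funpow_shift_t by simp
  qed
  moreover from this have "shift ` {..<N} = {..<N}"
    using shift_less by (intro endo_inj_surj) auto
  ultimately show ?thesis by (simp add: bij_betw_def)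
qed

section \<open>Polynomials with values in B and their coefficients\<close>

lemma poly_eq_sum_exponent:
  fixes T :: "'f poly"
  assumes deg: "degree T \<le> N" and "coeff T 0 = 0"
  shows "poly T y = (\<Sum>r<N. coeff T (exponent r) * y ^ exponent r)"
proof -
  have "poly T y = (\<Sum>i\<le>N. coeff T i * y ^ i)"
    unfolding poly_altdef using deg by (intro sum.mono_neutral_left) (auto simp: coeff_eq_0)
  also have "\<dots> = (\<Sum>i=1..N. coeff T i * y ^ i)"
    using assms by (intro sum.mono_neutral_right) (auto simp: not_less_eq_eq)
  also have "\<dots> = (\<Sum>r<N. coeff T (exponent r) * y ^ exponent r)"
    by (rule sum.reindex_bij_betw[OF bij_exponent, symmetric])
  finally show ?thesis .
qed

text \<open>By additivity of the power \<open>q\<close>, the values of \<open>T ^ q\<close> are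
  those of a polynomial of degree at most \<open>N\<close> whose coefficients are the powers
  \<open>a ^ q\<close>, moved along \<open>shift\<close>. Below degree \<open>N + 1\<close>, the
  size of F, equal values mean equal coefficients.\<close>

lemma poly_fixed_iff:
  fixes T :: "'f poly"
  assumes deg: "degree T \<le> N" and T0: "coeff T 0 = 0"
  shows "(\<forall>y. poly T y ^ q = poly T y) \<longleftrightarrow>
    (\<forall>r<N. coeff T (exponent (shift r)) = coeff T (exponent r) ^ q)"
proof -
  have pow: "poly T y ^ q = (\<Sum>r<N. coeff T (exponent r) ^ q * y ^ exponent (shift r))" for y
    unfolding poly_eq_sum_exponent[OF assms] frobenius_sum[OF primepow_q card_ext]
    by (simp only: power_mult_distrib power_exponent_shift)
  \<comment> \<open>The remainder of \<open>T ^ q\<close> modulo \<open>x ^ n - x\<close>, where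
    \<open>n\<close> is the size of F.\<close>
  define T' where "T' = (\<Sum>r<N. monom (coeff T (exponent r) ^ q) (exponent (shift r)))"
  have T': "poly T' y = poly T y ^ q" for y
    unfolding pow by (simp add: T'_def poly_sum poly_monom)
  have coeff_T': "coeff T' (exponent (shift r)) = coeff T (exponent r) ^ q" if r: "r < N" for r
  proof -
    \<comment> \<open>No two monomials of \<open>T'\<close> collide, since \<open>shift\<close> and
      \<open>exponent\<close> are injective on residues.\<close>
    have "exponent (shift r') = exponent (shift r) \<longleftrightarrow> r' = r" if "r' < N" for r'
      using exponent_eq_iff[OF shift_less shift_less] bij_shift r that
      by (auto simp: bij_betw_def inj_on_def)
    then have "coeff T' (exponent (shift r)) = (\<Sum>r'<N. if r' = r then coeff T (exponent r') ^ q else 0)"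
      unfolding T'_def coeff_sum by (intro sum.cong) auto
    then show ?thesis using r by simp
  qed
  have "degree T' \<le> N"
    unfolding T'_def
    by (intro degree_sum_le) (auto intro: order.trans[OF degree_monom_le] exponent_le shift_less)
  show ?thesis
  proof
    assume "\<forall>y. poly T y ^ q = poly T y"
    then have "T' = T"
      using \<open>degree T' \<le> N\<close> deg card_ext power_t_eq T' by (intro poly_eqI_degree[of UNIV]) auto
    then show "\<forall>r<N. coeff T (exponent (shift r)) = coeff T (exponent r) ^ q"
      using coeff_T' by auto
  next
    assume eq: "\<forall>r<N. coeff T (exponent (shift r)) = coeff T (exponent r) ^ q"
    show "\<forall>y. poly T y ^ q = poly T y"
    proof
      fix y
      have "poly T y = (\<Sum>r<N. coeff T (exponent (shift r)) * y ^ exponent (shift r))"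
        unfolding poly_eq_sum_exponent[OF assms]
        by (rule sum.reindex_bij_betw[OF bij_shift, symmetric])
      then show "poly T y ^ q = poly T y" unfolding pow using eq by simp
    qed
  qed
qed

text \<open>The bounds are imposed on the whole orbit because a coefficient that vanishes at one
  exponent vanishes along its entire coset. \<open>D\<close> is an integer since the degree bound
  may be negative.\<close>

definition admissible :: "int \<Rightarrow> nat set" where
  "admissible D = {r. r < N \<and> (\<forall>x\<in>orbit shift r. 2 \<le> exponent x \<and> int (exponent x) \<le> D)}"

definition fixed_polys :: "int \<Rightarrow> 'f poly set" where
  "fixed_polys D = {T. (\<forall>y. poly T y ^ q = poly T y) \<and>
     (\<forall>i. coeff T i \<noteq> 0 \<longrightarrow> 2 \<le> i \<and> int i \<le> D)}"

lemma shift_admissible_iff: "r < N \<Longrightarrow> shift r \<in> admissible D \<longleftrightarrow> r \<in> admissible D"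
  using self_in_orbit_step[OF self_in_orbit_shift] shift_less by (simp add: admissible_def)

lemma fixed_polysD:
  assumes "T \<in> fixed_polys D" "D \<le> int N"
  shows "degree T \<le> N" "coeff T 0 = 0"
    and "\<And>r. r < N \<Longrightarrow> coeff T (exponent (shift r)) = coeff T (exponent r) ^ q"
proof -
  show deg: "degree T \<le> N"
  proof (rule degree_le, safe)
    fix i assume "N < i"
    then show "coeff T i = 0" using assms by (fastforce simp: fixed_polys_def)
  qed
  show T0: "coeff T 0 = 0" using assms by (auto simp: fixed_polys_def)
  show "\<And>r. r < N \<Longrightarrow> coeff T (exponent (shift r)) = coeff T (exponent r) ^ q"
    using poly_fixed_iff[OF deg T0] assms by (auto simp: fixed_polys_def)
qed

text \<open>Since \<open>y ^ q = 0\<close> only for \<open>y = 0\<close>, vanishing passes along the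
  orbit in both directions, starting from an exponent that is out of bounds.\<close>

lemma coeff_fixed_poly_eq_0:
  assumes T: "T \<in> fixed_polys D" and D: "D \<le> int N" and r: "r < N" "r \<notin> admissible D"
  shows "coeff T (exponent r) = 0"
proof -
  obtain x where x: "x \<in> orbit shift r" "\<not> (2 \<le> exponent x \<and> int (exponent x) \<le> D)"
    using r by (auto simp: admissible_def)
  have "coeff T (exponent x) = 0" using T x(2) by (auto simp: fixed_polys_def)
  moreover have "coeff T (exponent x) = 0 \<longleftrightarrow> coeff T (exponent r) = 0"
    using x(1)
  proof induction
    case base
    then show ?case using fixed_polysD(3)[OF T D r(1)] q_gt_1 by simp
  next
    case (step x)
    then show ?case
      using fixed_polysD(3)[OF T D, of x] orbit_shift_subset[of r] q_gt_1 by auto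
  qed
  ultimately show ?thesis by simp
qed

lemma bij_fixed_polys_equivariant_maps:
  assumes D: "D \<le> int N"
  shows "bij_betw (\<lambda>T. \<lambda>r\<in>admissible D. coeff T (exponent r)) (fixed_polys D)
    (equivariant_maps (admissible D) shift (\<lambda>y. y ^ q))"
proof (rule bij_betw_imageI)
  have adm: "r < N" if "r \<in> admissible D" for r using that by (simp add: admissible_def)
  show "inj_on (\<lambda>T. \<lambda>r\<in>admissible D. coeff T (exponent r)) (fixed_polys D)"
  proof (rule inj_onI)
    fix T U assume T: "T \<in> fixed_polys D" and U: "U \<in> fixed_polys D"
      and eq: "(\<lambda>r\<in>admissible D. coeff T (exponent r)) = (\<lambda>r\<in>admissible D. coeff U (exponent r))"
    have *: "coeff T (exponent r) = coeff U (exponent r)" if "r < N" for r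
      using fun_cong[OF eq, of r] coeff_fixed_poly_eq_0[OF T D that] coeff_fixed_poly_eq_0[OF U D that]
      by (cases "r \<in> admissible D") auto
    show "T = U"
    proof (rule poly_eqI)
      fix i
      \<comment> \<open>Degree 0 and degrees above \<open>N\<close> carry no coefficient; every
        other degree is the exponent of a residue.\<close>
      consider "i = 0" | "i > N" | "i \<in> exponent ` {..<N}"
        using bij_exponent by (force simp: bij_betw_def)
      then show "coeff T i = coeff U i"
        using fixed_polysD(1,2)[OF T D] fixed_polysD(1,2)[OF U D] *
        by cases (auto simp: coeff_eq_0)
    qed
  qed
  show "(\<lambda>T. \<lambda>r\<in>admissible D. coeff T (exponent r)) ` fixed_polys D =
    equivariant_maps (admissible D) shift (\<lambda>y. y ^ q)"
  proof (intro equalityI subsetI)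
    fix a assume "a \<in> (\<lambda>T. \<lambda>r\<in>admissible D. coeff T (exponent r)) ` fixed_polys D"
    then show "a \<in> equivariant_maps (admissible D) shift (\<lambda>y. y ^ q)"
      using fixed_polysD(3)[OF _ D] adm shift_admissible_iff by (auto simp: equivariant_maps_def)
  next
    fix a :: "nat \<Rightarrow> 'f"
    assume a: "a \<in> equivariant_maps (admissible D) shift (\<lambda>y. y ^ q)"
    define T where "T = (\<Sum>r\<in>admissible D. monom (a r) (exponent r))"
    have fin: "finite (admissible D)" by (rule finite_subset[of _ "{..<N}"]) (auto simp: admissible_def)
    have coeff_T: "coeff T (exponent r) = (if r \<in> admissible D then a r else 0)" if "r < N" for r
    proof -
      have "coeff T (exponent r) = (\<Sum>r'\<in>admissible D. if r' = r then a r' else 0)"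
        unfolding T_def coeff_sum using exponent_eq_iff adm that by (intro sum.cong) auto
      then show ?thesis using fin by simp
    qed
    have supp: "\<exists>r\<in>admissible D. i = exponent r" if "coeff T i \<noteq> 0" for i
    proof (rule ccontr)
      assume "\<not> ?thesis"
      then have "coeff T i = (\<Sum>r\<in>admissible D. 0)"
        unfolding T_def coeff_sum by (intro sum.cong) auto
      then show False using that by simp
    qed
    have bounds: "2 \<le> i \<and> int i \<le> D" if "coeff T i \<noteq> 0" for i
      using supp[OF that] self_in_orbit_shift by (auto simp: admissible_def)
    have "degree T \<le> N"
      using bounds D by (intro degree_le) force
    moreover have "coeff T 0 = 0" using bounds[of 0] by auto
    \<comment> \<open>Off \<open>admissible D\<close> both sides are 0, because \<open>shift\<close>
      also preserves inadmissibility.\<close>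
    moreover have "coeff T (exponent (shift r)) = coeff T (exponent r) ^ q" if "r < N" for r
      using coeff_T[OF that] coeff_T[OF shift_less, of r] shift_admissible_iff[OF that] a q_gt_1
      by (auto simp: equivariant_maps_def)
    ultimately have "T \<in> fixed_polys D"
      using poly_fixed_iff bounds by (auto simp: fixed_polys_def)
    moreover have "a = (\<lambda>r\<in>admissible D. coeff T (exponent r))"
      using a by (intro PiE_ext[of a "admissible D" "\<lambda>_. UNIV"])
        (simp_all add: equivariant_maps_def coeff_T adm)
    ultimately show "a \<in> (\<lambda>T. \<lambda>r\<in>admissible D. coeff T (exponent r)) ` fixed_polys D" by blast
  qed
qed

text \<open>The orbit \<open>C\<close> contributes the number of roots of
  \<open>y ^ (q ^ card C) = y\<close>, which is \<open>q ^ card C\<close> as \<open>card C\<close>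
  divides \<open>t\<close>.\<close>

lemma card_fixed_polys:
  assumes D: "D \<le> int N"
  shows "finite (fixed_polys D)"
    and "card (fixed_polys D) = q ^ (\<Sum>C\<in>orbit shift ` admissible D. card C)"
proof -
  let ?X = "admissible D"
  have fin: "finite ?X" by (rule finite_subset[of _ "{..<N}"]) (auto simp: admissible_def)
  have "equivariant_maps ?X shift (\<lambda>y::'f. y ^ q) \<subseteq> ?X \<rightarrow>\<^sub>E UNIV"
    by (auto simp: equivariant_maps_def)
  then have "finite (equivariant_maps ?X shift (\<lambda>y::'f. y ^ q))"
    by (rule finite_subset) (auto intro: finite_PiE fin)
  then show "finite (fixed_polys D)"
    using bij_betw_finite[OF bij_fixed_polys_equivariant_maps[OF D]] by simp
  have adm: "r < N" if "r \<in> ?X" for r using that by (simp add: admissible_def)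
  have "card (fixed_polys D) = card (equivariant_maps ?X shift (\<lambda>y::'f. y ^ q))"
    by (rule bij_betw_same_card[OF bij_fixed_polys_equivariant_maps[OF D]])
  also have "\<dots> = (\<Prod>C\<in>orbit shift ` ?X. card {y::'f. ((\<lambda>y. y ^ q) ^^ card C) y = y})"
    using fin shift_admissible_iff adm self_in_orbit_shift by (intro card_equivariant_maps) auto
  also have "\<dots> = (\<Prod>C\<in>orbit shift ` ?X. q ^ card C)"
    unfolding funpow_power
    using card_power_fixed_points[OF card_ext] card_orbit_dvd card_orbit_pos adm
    by (intro prod.cong) auto
  also have "\<dots> = q ^ (\<Sum>C\<in>orbit shift ` ?X. card C)" by (simp add: power_sum)
  finally show "card (fixed_polys D) = q ^ (\<Sum>C\<in>orbit shift ` ?X. card C)" .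
qed

section \<open>Valid cosets and the two spaces in terms of exponents\<close>

lemma cyclotomic_cosets_eq: "cyclotomic_cosets q t = orbit shift ` {..<N}"
proof -
  have "{0..q ^ t - 2} = {..<N}" using N_pos power_t_eq by auto
  moreover have "(\<lambda>a. q * a mod (q ^ t - 1)) = shift" by (simp add: fun_eq_iff shift_def N_def)
  ultimately show ?thesis by (simp add: cyclotomic_cosets_def)
qed

text \<open>If \<open>N > 1\<close>, residue 0 stands for \<open>N\<close>, which is at least 2. If
  \<open>N = 1\<close>, the only residue is \<open>0 = 1 mod N\<close>, with exponent 1.\<close>

lemma two_le_exponent_iff: "r < N \<Longrightarrow> 2 \<le> exponent r \<longleftrightarrow> r \<noteq> 1 mod N"
  using N_pos by (cases "N = 1") (auto simp: exponent_def)

text \<open>A bound below \<open>N\<close> rules out the exponent \<open>N\<close>, which is the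
  condition that 0 is not in the coset; every other residue is its own exponent.\<close>

lemma bounded_cosets_eq:
  assumes "int (q ^ t) - int k - int s < int N"
  shows "bounded_cosets q t k s = orbit shift ` admissible (int (q ^ t) - int k - int s)"
proof -
  define D where "D = int (q ^ t) - int k - int s"
  have "0 \<notin> C \<and> 1 mod N \<notin> C \<and> int (Max C) \<le> D \<longleftrightarrow>
      (\<forall>x\<in>C. 2 \<le> exponent x \<and> int (exponent x) \<le> D)"
    if "r < N" "C = orbit shift r" for r C
  proof -
    have C: "finite C" "C \<noteq> {}" "C \<subseteq> {..<N}"
      using that finite_orbit[OF self_in_orbit_shift] orbit_nonempty[of shift r] orbit_shift_subset
      by auto
    have "int (Max C) \<le> D \<longleftrightarrow> (\<forall>x\<in>C. int x \<le> D)"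
    proof
      assume "int (Max C) \<le> D"
      then show "\<forall>x\<in>C. int x \<le> D" using Max_ge[OF C(1)] by fastforce
    qed (use Max_in[OF C(1,2)] in auto)
    moreover have "x \<noteq> 0 \<and> x \<noteq> 1 mod N \<and> int x \<le> D \<longleftrightarrow> 2 \<le> exponent x \<and> int (exponent x) \<le> D"
      if "x \<in> C" for x
    proof -
      have "x < N" using C that by auto
      then show ?thesis
        using two_le_exponent_iff[of x] assms by (auto simp: exponent_def D_def)
    qed
    ultimately show ?thesis by metis
  qed
  then show ?thesis
    unfolding bounded_cosets_def cyclotomic_cosets_eq N_def[symmetric] D_def[symmetric] admissible_def
    by blast
qed

text \<open>With bound \<open>N\<close> the exponent \<open>N\<close> is allowed, so the coset of 0
  may take part, and only the exponent 1 is forbidden.\<close>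

lemma unbounded_cosets_eq:
  "{C \<in> cyclotomic_cosets q t. 1 mod N \<notin> C} = orbit shift ` admissible (int N)"
proof -
  have "1 mod N \<notin> orbit shift r \<longleftrightarrow>
      (\<forall>x\<in>orbit shift r. 2 \<le> exponent x \<and> int (exponent x) \<le> int N)" for r
    using orbit_shift_subset[of r] two_le_exponent_iff exponent_le by (force simp: subset_iff)
  then show ?thesis unfolding cyclotomic_cosets_eq admissible_def by blast
qed

text \<open>As \<open>g\<close> does not vanish at 0, \<open>x\<close> divides \<open>g T\<close>
  and \<open>h\<close> vanishes at 0 exactly when \<open>x ^ 2\<close> divides \<open>T\<close>. For
  nonzero \<open>T\<close> of this kind, \<open>deg h = |S| + deg T - 1\<close>, which turns the
  bound on \<open>h\<close> into one on \<open>T\<close>.\<close>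

lemma V_space_eq:
  assumes "0 \<notin> S"
  shows "V_space emb k S = fixed_polys (int (q ^ t) - int k - int (card S))"
proof -
  let ?G = "g_poly S" and ?D = "int (q ^ t) - int k - int (card S)"
  have "poly ?G 0 \<noteq> 0" using assms by (auto simp: g_poly_def poly_prod)
  then have G0: "coeff ?G 0 \<noteq> 0" "?G \<noteq> 0" by (auto simp: poly_0_coeff_0)
  have degG: "degree ?G = card S"
    unfolding g_poly_def by (subst degree_prod_eq_sum_degree) auto
  have "trace_repair_compatible emb k S T \<longleftrightarrow> T \<in> fixed_polys ?D" for T
  proof (cases "coeff T 0 = 0 \<and> coeff T 1 = 0")
    case True
    then obtain U where T: "T = pCons 0 U" by (cases T) auto
    have "coeff U 0 = 0" using True T by simp
    have "?G * T = [:0, 1:] * (?G * U)" by (simp add: T)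
    then have h: "h_poly S T = ?G * U"
      unfolding h_poly_def by (simp only:) (rule nonzero_mult_div_cancel_left, simp)
    have deg: "h_poly S T = 0 \<or> int (degree (h_poly S T)) \<le> int CARD('f) - int k - 1 \<longleftrightarrow>
        (\<forall>i. coeff T i \<noteq> 0 \<longrightarrow> int i \<le> ?D)"
    proof (cases "U = 0")
      case False
      have "int (degree (h_poly S T)) \<le> int CARD('f) - int k - 1 \<longleftrightarrow> int (degree T) \<le> ?D"
        unfolding h using False G0 degG card_ext by (auto simp: degree_mult_eq T)
      moreover have "int (degree T) \<le> ?D \<longleftrightarrow> (\<forall>i. coeff T i \<noteq> 0 \<longrightarrow> int i \<le> ?D)"
      proof
        assume "int (degree T) \<le> ?D"
        then show "\<forall>i. coeff T i \<noteq> 0 \<longrightarrow> int i \<le> ?D" using le_degree[of T] by fastforce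
      next
        assume "\<forall>i. coeff T i \<noteq> 0 \<longrightarrow> int i \<le> ?D"
        moreover have "coeff T (degree T) \<noteq> 0" using False T by simp
        ultimately show "int (degree T) \<le> ?D" by blast
      qed
      ultimately show ?thesis using False G0 h by simp
    qed (simp add: T h_poly_def)
    have "[:0, 1:] dvd ?G * T" unfolding T by (intro dvd_mult) (simp add: dvd_def exI[of _ U])
    moreover have "poly (h_poly S T) 0 = 0" using \<open>coeff U 0 = 0\<close> by (simp add: h poly_0_coeff_0 coeff_mult)
    moreover have "2 \<le> i" if "coeff T i \<noteq> 0" for i
      using that True by (cases "i = 0 \<or> i = 1") auto
    ultimately show ?thesis
      unfolding trace_repair_compatible_def fixed_polys_def mem_Collect_eq deg
        range_field_embedding[OF emb card_base] by blast
  next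
    case False
    have "\<not> trace_repair_compatible emb k S T"
    proof
      assume T: "trace_repair_compatible emb k S T"
      then obtain V where V: "?G * T = [:0, 1:] * V" by (auto simp: trace_repair_compatible_def)
      then have "h_poly S T = V"
        unfolding h_poly_def by (simp only:) (rule nonzero_mult_div_cancel_left, simp)
      then have V0: "coeff V 0 = 0"
        using T by (simp add: trace_repair_compatible_def poly_0_coeff_0)
      \<comment> \<open>The constant coefficient of \<open>g\<close> being nonzero, these two
        equations force the coefficients of \<open>T\<close> at 0 and then at 1 to vanish.\<close>
      have "coeff (?G * T) 0 = 0" "coeff (?G * T) 1 = 0" using V0 by (simp_all add: V)
      then show False using False G0 by (auto simp: coeff_mult)
    qed
    moreover have "T \<notin> fixed_polys ?D" using False by (force simp: fixed_polys_def)
    ultimately show ?thesis by simp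
  qed
  then show ?thesis by (auto simp: V_space_def)
qed

text \<open>For \<open>k \<ge> 1\<close> the degree of \<open>h\<close> is below the size of F, so
  the values determine \<open>h\<close>, and \<open>T\<close> is recovered from
  \<open>x h = g T\<close>.\<close>

lemma card_W_space:
  assumes "k \<ge> 1"
  shows "card (W_space emb k S) = card (V_space emb k S)"
proof -
  have W: "W_space emb k S = (\<lambda>T. \<chi> \<alpha>. poly (h_poly S T) \<alpha>) ` V_space emb k S"
    by (auto simp: W_space_def V_space_def)
  have "inj_on (\<lambda>T. \<chi> \<alpha>. poly (h_poly S T) \<alpha>) (V_space emb k S)"
  proof (rule inj_onI)
    fix T U assume T: "T \<in> V_space emb k S" and U: "U \<in> V_space emb k S"
      and "(\<chi> \<alpha>. poly (h_poly S T) \<alpha>) = (\<chi> \<alpha>. poly (h_poly S U) \<alpha>)"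
    then have "poly (h_poly S T) \<alpha> = poly (h_poly S U) \<alpha>" for \<alpha>
      by (simp add: vec_eq_iff)
    moreover have "degree (h_poly S R) < CARD('f)" if "R \<in> V_space emb k S" for R
      using that assms by (auto simp: V_space_def trace_repair_compatible_def)
    ultimately have "h_poly S T = h_poly S U"
      using T U by (intro poly_eqI_degree[of UNIV]) auto
    moreover have "[:0, 1:] * h_poly S R = g_poly S * R" if "R \<in> V_space emb k S" for R
      using that unfolding h_poly_def
      by (intro dvd_mult_div_cancel) (simp add: V_space_def trace_repair_compatible_def)
    ultimately have "g_poly S * T = g_poly S * U" using T U by metis
    moreover have "g_poly S \<noteq> 0" by (simp add: g_poly_def)
    ultimately show "T = U" by simp
  qed
  then show ?thesis unfolding W by (rule card_image)
qed

end

section \<open>The dimension formula\<close>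

theorem theorem9:
  fixes emb :: "'b::{field,finite} \<Rightarrow> 'f::{field,finite}"
    and q t k :: nat and S :: "'f set"
  assumes "primepow q" and "t \<ge> 1"
    and "CARD('b) = q" and "CARD('f) = q ^ t"
    and "field_embedding emb"
    and "1 \<le> k" and "k \<le> q ^ t"
    and "S \<subseteq> UNIV - {0}"
  shows "vector_space.dim (\<lambda>b v. emb b *s v) (W_space emb k S)
           = vector_space.dim (\<lambda>b. smult (emb b)) (V_space emb k S) \<and>
         (k \<ge> 2 \<or> S = {} \<longrightarrow>
            vector_space.dim (\<lambda>b. smult (emb b)) (V_space emb k S)
              = (\<Sum>C\<in>valid_cosets q t k (card S). card C)) \<and>
         (k = 1 \<and> S \<noteq> {} \<longrightarrow>
            vector_space.dim (\<lambda>b. smult (emb b)) (V_space emb k S)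
              = (\<Sum>C\<in>bounded_cosets q t k (card S). card C))"
proof -
  interpret finite_field_extension emb q t
    using assms by unfold_locales auto
  interpret V: vector_space "\<lambda>b. smult (emb b)" by (rule vector_space_poly[OF emb])
  interpret W: vector_space "\<lambda>b (v :: ('f, 'f) vec). emb b *s v"
    by (rule vector_space_vec[OF emb])
  define D where "D = int (q ^ t) - int k - int (card S)"
  have V_eq: "V_space emb k S = fixed_polys D"
    unfolding D_def using assms by (intro V_space_eq) auto
  have D_le: "D \<le> int N" using assms by (simp add: D_def power_t_eq)
  \<comment> \<open>Polynomials form an infinite type, so finiteness of this space comes from the
    count; vectors over F indexed by F form a finite type.\<close>
  have dim_V: "card (V_space emb k S) = q ^ V.dim (V_space emb k S)"
    using V.card_subspace[OF _ _ subspace_V_space[OF emb]] card_fixed_polys(1)[OF D_le, folded V_eq]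
    by (simp add: card_base)
  have dim_W: "card (W_space emb k S) = q ^ W.dim (W_space emb k S)"
    using W.card_subspace[OF _ _ subspace_W_space[OF emb]] by (simp add: card_base)
  have "W.dim (W_space emb k S) = V.dim (V_space emb k S)"
    using dim_V dim_W card_W_space[OF \<open>1 \<le> k\<close>, of S] q_gt_1 by simp
  moreover have dim: "V.dim (V_space emb k S) = (\<Sum>C\<in>orbit shift ` admissible D. card C)"
    using dim_V card_fixed_polys(2)[OF D_le] q_gt_1 by (simp add: V_eq)
  \<comment> \<open>Here \<open>k + card S \<ge> 2\<close>, which gives \<open>D < N\<close>. The
    remaining case \<open>k = 1\<close>, \<open>S = {}\<close> is the one with
    \<open>D = N\<close>.\<close>
  moreover have bounded: "bounded_cosets q t k (card S) = orbit shift ` admissible D"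
    if "k \<ge> 2 \<or> S \<noteq> {}"
  proof -
    have "S \<noteq> {} \<Longrightarrow> card S > 0" by (simp add: card_gt_0_iff)
    then have "k + card S \<ge> 2" using that \<open>1 \<le> k\<close> by linarith
    then show ?thesis unfolding D_def by (intro bounded_cosets_eq) (simp add: power_t_eq)
  qed
  moreover have "valid_cosets q t k (card S) = orbit shift ` admissible D" if "k \<ge> 2 \<or> S = {}"
  proof (cases "k \<ge> 2")
    case False
    then have "D = int N" using that \<open>1 \<le> k\<close> by (simp add: D_def power_t_eq)
    then show ?thesis using False unbounded_cosets_eq by (simp add: valid_cosets_def N_def)
  qed (use bounded in \<open>simp add: valid_cosets_def\<close>)
  ultimately show ?thesis by metis
qed

end
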